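(* Let $\mathcal{L}=\langle L,\mathcal{F},\mathcal{P}\rangle$ be a computation states structure satisfying the hypotheses in the context, fix a predicate $P\in\mathcal{P}$, and let $\mathfrak{f}=(\mathfrak{f}_v)_{v\in L}$ be an arbitrary function $P$-type. Then the following are equivalent: (i) $\mathfrak{f}$ is definable, i.e. the map $L\to\mathbb{R}$, $v\mapsto\mathfrak{f}_v$, is a definable predicate; (ii) the map $L\to\mathbb{R}$, $v\mapsto\mathfrak{f}_v$, is continuous with respect to the type topology on $L$; equivalently, whenever $\mathfrak{f}=\mathcal{U}\text{-}\lim_i (P(f_i(v)))_{v\in L}$ for a family $(f_i)_{i\in I}\subseteq\mathcal{F}$ and an ultrafilter $\mathcal{U}$ on $I$, one has $\mathcal{U}\text{-}\lim_i\mathcal{V}\text{-}\lim_j P(f_i(v_j))=\mathcal{V}\text{-}\lim_j\mathcal{U}\text{-}\lim_i P(f_i(v_j))$ for every family $(v_j)_{j\in J}\subseteq L$ and every ultrafilter $\mathcal{V}$ on $J$; (iii) for every $\varepsilon>0$ there exist finitely many $h_1,\dots,h_l\in\mathcal{F}$ and an explicit predicate $\eta_\varepsilon$ built using the connectives from constant predicates and the predicates $v\mapsto P(h_k(v))$, $k=1,\dots,l$, such that $\sup_{v\in L}|\eta_\varepsilon(v)-\mathfrak{f}_v|<\varepsilon$.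
   Context: A computation states structure is a triple $\langle L,\mathcal{F},\mathcal{P}\rangle$ with $L$ a set, $\mathcal{F}$ a collection of functions on $L$, and $\mathcal{P}$ a collection of functions $L\to\mathbb{R}$ (predicates). The type topology on $L$ is induced by the pseudometrics $d_P(v,w)=|P(v)-P(w)|$, $P\in\mathcal{P}$ (states with identical predicate values identified). Hypotheses: there are bounds $\bar r=(r_P)_{P\in\mathcal{P}}$, $r_P\ge0$, such that $|Q(v)|\le r_Q$ for all $v\in L$, $Q\in\mathcal{P}$ (so $L$ is itself a generalized closed disk); $L$ is complete with respect to the pseudometrics $(d_Q)_{Q\in\mathcal{P}}$ (hence compact); every $f\in\mathcal{F}$ is a unary continuous map $L\to L$; the identity map belongs to $\mathcal{F}$; and $\mathcal{F}$ is closed under composition. Write ${}_P\mathbb{R}=[-r_P,r_P]$. The space of function $P$-types is the closure, in the product space ${}_P\mathbb{R}^L$ (product topology, i.e. pointwise convergence), of the set $\{(P(f(v)))_{v\in L}: f\in\mathcal{F}\}$; a function $P$-type is an element $\mathfrak{f}=(\mathfrak{f}_v)_{v\in L}$ of this space. An atomic predicate is a map $v\mapsto Q(g(v))$ with $Q\in\mathcal{P}$, $g\in\mathcal{F}$. An explicit predicate is any function $L\to\mathbb{R}$ obtained from constant functions and atomic predicates by finitely many applications of the connectives: pointwise addition, multiplication by a real scalar, pointwise maximum and pointwise minimum. A definable predicate is a function $\xi:L\to\mathbb{R}$ such that for every $\varepsilon>0$ there is an explicit predicate $\eta$ with $|\eta(v)-\xi(v)|<\varepsilon$ for all $v\in L$.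 $\mathcal{U}\text{-}\lim$ denotes the limit along an ultrafilter. *)

theory Defs
  imports "HOL-Analysis.Analysis"
begin

text \<open>
  A computation states structure consists of a set \<open>L\<close>, a set \<open>F\<close> of maps \<open>L \<rightarrow> L\<close> and a set
  \<open>Ps\<close> of maps \<open>L \<rightarrow> \<real>\<close>. Functions with domain \<open>L\<close> are represented extensionally (they take
  the value \<^const>\<open>undefined\<close> outside \<open>L\<close>), so that equality of such functions is
  equality on \<open>L\<close>.
\<close>

definition type_dist :: "('a \<Rightarrow> real) \<Rightarrow> 'a \<Rightarrow> 'a \<Rightarrow> real" where
  "type_dist Q v w = \<bar>Q v - Q w\<bar>"

text \<open>
  The open balls of all the pseudometrics form a subbase. The set \<open>L\<close> itself only matters if
  \<open>Ps\<close> is empty. The topology is not assumed to be \<open>T\<^sub>0\<close>: states with identical predicate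
  values are topologically indistinguishable, but need not be equal.
\<close>

definition type_topology :: "'a set \<Rightarrow> ('a \<Rightarrow> real) set \<Rightarrow> 'a topology" where
  "type_topology L Ps = topology_generated_by
     (insert L {{w \<in> L. type_dist Q v w < e} | Q v e. Q \<in> Ps \<and> v \<in> L \<and> 0 < e})"

text \<open>
  Completeness of the uniformity generated by the pseudometrics. As there may be uncountably
  many of them, it is expressed with Cauchy filters instead of Cauchy sequences.
\<close>

definition type_cauchy_filter :: "('a \<Rightarrow> real) set \<Rightarrow> 'a filter \<Rightarrow> bool" where
  "type_cauchy_filter Ps C \<longleftrightarrow>
     (\<forall>Q\<in>Ps. \<forall>e>0. \<forall>\<^sub>F (v, w) in C \<times>\<^sub>F C. type_dist Q v w < e)"

definition type_complete :: "'a set \<Rightarrow> ('a \<Rightarrow> real) set \<Rightarrow> bool" where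
  "type_complete L Ps \<longleftrightarrow>
     (\<forall>C. C \<noteq> bot \<and> (\<forall>\<^sub>F v in C. v \<in> L) \<and> type_cauchy_filter Ps C \<longrightarrow>
          (\<exists>l\<in>L. limitin (type_topology L Ps) (\<lambda>v. v) l C))"

locale complete_bounded_css =
  fixes L :: "'a set"
    and F :: "('a \<Rightarrow> 'a) set"
    and Ps :: "('a \<Rightarrow> real) set"
    and r :: "('a \<Rightarrow> real) \<Rightarrow> real"
  assumes transformations: "F \<subseteq> L \<rightarrow>\<^sub>E L"
    and predicates: "Ps \<subseteq> extensional L"
    and bound_nonneg: "Q \<in> Ps \<Longrightarrow> 0 \<le> r Q"
    and bounded: "Q \<in> Ps \<Longrightarrow> v \<in> L \<Longrightarrow> \<bar>Q v\<bar> \<le> r Q"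
    and complete: "type_complete L Ps"
    and continuous:
      "f \<in> F \<Longrightarrow> continuous_map (type_topology L Ps) (type_topology L Ps) f"
    and identity: "(\<lambda>v\<in>L. v) \<in> F"
    and composition: "f \<in> F \<Longrightarrow> g \<in> F \<Longrightarrow> compose L f g \<in> F"

definition function_types ::
  "'a set \<Rightarrow> ('a \<Rightarrow> 'a) set \<Rightarrow> (('a \<Rightarrow> real) \<Rightarrow> real) \<Rightarrow> ('a \<Rightarrow> real) \<Rightarrow> ('a \<Rightarrow> real) set" where
  "function_types L F r P =
     product_topology (\<lambda>_. top_of_set {- r P..r P}) L closure_of {\<lambda>v\<in>L. P (f v) | f. f \<in> F}"

definition atomic_predicates ::
  "'a set \<Rightarrow> ('a \<Rightarrow> 'a) set \<Rightarrow> ('a \<Rightarrow> real) set \<Rightarrow> ('a \<Rightarrow> real) set" where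
  "atomic_predicates L F Ps = {\<lambda>v\<in>L. Q (g v) | Q g. Q \<in> Ps \<and> g \<in> F}"

text \<open>The functions built with the connectives from constants and from the functions in \<open>A\<close>.\<close>

inductive_set connective_closure :: "'a set \<Rightarrow> ('a \<Rightarrow> real) set \<Rightarrow> ('a \<Rightarrow> real) set"
  for L :: "'a set" and A :: "('a \<Rightarrow> real) set" where
  const: "(\<lambda>v\<in>L. c) \<in> connective_closure L A"
| base: "a \<in> A \<Longrightarrow> a \<in> connective_closure L A"
| add: "a \<in> connective_closure L A \<Longrightarrow> b \<in> connective_closure L A \<Longrightarrow>
    (\<lambda>v\<in>L. a v + b v) \<in> connective_closure L A"
| scale: "a \<in> connective_closure L A \<Longrightarrow> (\<lambda>v\<in>L. c * a v) \<in> connective_closure L A"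
| max: "a \<in> connective_closure L A \<Longrightarrow> b \<in> connective_closure L A \<Longrightarrow>
    (\<lambda>v\<in>L. max (a v) (b v)) \<in> connective_closure L A"
| min: "a \<in> connective_closure L A \<Longrightarrow> b \<in> connective_closure L A \<Longrightarrow>
    (\<lambda>v\<in>L. min (a v) (b v)) \<in> connective_closure L A"

definition explicit_predicates ::
  "'a set \<Rightarrow> ('a \<Rightarrow> 'a) set \<Rightarrow> ('a \<Rightarrow> real) set \<Rightarrow> ('a \<Rightarrow> real) set" where
  "explicit_predicates L F Ps = connective_closure L (atomic_predicates L F Ps)"

definition definable_predicate ::
  "'a set \<Rightarrow> ('a \<Rightarrow> 'a) set \<Rightarrow> ('a \<Rightarrow> real) set \<Rightarrow> ('a \<Rightarrow> real) \<Rightarrow> bool" where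
  "definable_predicate L F Ps \<xi> \<longleftrightarrow>
     (\<forall>\<epsilon>>0. \<exists>\<eta>\<in>explicit_predicates L F Ps. \<forall>v\<in>L. \<bar>\<eta> v - \<xi> v\<bar> < \<epsilon>)"

text \<open>An ultrafilter on a set \<open>I\<close> is a filter on the ambient type that is concentrated on \<open>I\<close>.\<close>

definition ultrafilter_on :: "'i set \<Rightarrow> 'i filter \<Rightarrow> bool" where
  "ultrafilter_on I U \<longleftrightarrow>
     U \<noteq> bot \<and> (\<forall>\<^sub>F i in U. i \<in> I) \<and>
     (\<forall>S. S \<subseteq> I \<longrightarrow> (\<forall>\<^sub>F i in U. i \<in> S) \<or> (\<forall>\<^sub>F i in U. i \<in> I - S))"

text \<open>
  Exchange of iterated ultralimits for all families indexed by the given sets \<open>I\<close> and \<open>J\<close>.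
  All the ultralimits occurring here are limits of bounded real families, so they exist and
  \<^const>\<open>Lim\<close> denotes them.
\<close>

definition iterated_limits_commute ::
  "'a set \<Rightarrow> ('a \<Rightarrow> 'a) set \<Rightarrow> ('a \<Rightarrow> real) \<Rightarrow> ('a \<Rightarrow> real) \<Rightarrow> 'i set \<Rightarrow> 'j set \<Rightarrow> bool" where
  "iterated_limits_commute L F P \<ff> I J \<longleftrightarrow>
     (\<forall>f U. f ` I \<subseteq> F \<and> ultrafilter_on I U \<and> (\<forall>v\<in>L. ((\<lambda>i. P (f i v)) \<longlongrightarrow> \<ff> v) U) \<longrightarrow>
        (\<forall>v V. v ` J \<subseteq> L \<and> ultrafilter_on J V \<longrightarrow>
           Lim U (\<lambda>i. Lim V (\<lambda>j. P (f i (v j)))) = Lim V (\<lambda>j. Lim U (\<lambda>i. P (f i (v j))))))"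

text \<open>
  A formula cannot quantify over the types of the index sets. In the condition below the index
  sets range over the subsets of the types \<open>'a \<Rightarrow> 'a\<close> and \<open>'a\<close>; in particular \<open>F\<close> and \<open>L\<close>
  themselves occur as index sets. Nothing is lost: an ultrafilter on an arbitrary index set can
  be pushed forward along the family to \<open>F\<close> (respectively \<open>L\<close>), which does not change the limits.
  To assert the condition for all index sets outright, \<open>iterated_limits_commute\<close> is to be used
  with index sets over free type variables.
\<close>

definition iterated_limits_commute_canonical ::
  "'a set \<Rightarrow> ('a \<Rightarrow> 'a) set \<Rightarrow> ('a \<Rightarrow> real) \<Rightarrow> ('a \<Rightarrow> real) \<Rightarrow> bool" where
  "iterated_limits_commute_canonical L F P \<ff> \<longleftrightarrow>
     (\<forall>(I :: ('a \<Rightarrow> 'a) set) (J :: 'a set). iterated_limits_commute L F P \<ff> I J)"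

end

theory Submission
  imports Defs
begin

text \<open>
  Bounded real families converge along ultrafilters, so completeness makes every family in \<open>L\<close>
  converge along every ultrafilter; in particular \<open>L\<close> is compact. A continuous function type is
  a pointwise limit of functions \<open>v \<mapsto> P (f v)\<close>, hence is approximated by a single such function
  at any two given points. Kakutani's lattice argument (finite minima, then finite maxima, by
  compactness) turns this into uniform approximation, and no linear combinations are needed.
\<close>

section \<open>Ultrafilters\<close>

text \<open>Zorn's lemma yields a finest proper filter \<open>U\<close> below \<open>G\<close>; the
  order is reversed, so that upper bounds of chains are infima. Such a \<open>U\<close> decides
  every set \<open>S\<close>: if \<open>inf U (principal S)\<close> is proper, minimality makes it
  equal to \<open>U\<close>, and otherwise \<open>U\<close> eventually avoids
  \<open>S\<close>.\<close>

lemma ex_ultrafilter_le: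
  fixes G :: "'i filter"
  assumes "G \<noteq> bot" and "\<forall>\<^sub>F i in G. i \<in> I"
  obtains U where "U \<le> G" and "ultrafilter_on I U"
proof -
  define A where "A = {H. H \<noteq> bot \<and> H \<le> G}"
  have po: "partial_order_on A (relation_of (\<ge>) A)"
    by (rule partial_order_on_relation_ofI) auto
  have ub: "\<exists>u\<in>A. \<forall>a\<in>C. a \<ge> u" if C: "C \<in> Chains (relation_of (\<ge>) A)" for C
  proof (cases "C = {}")
    case True
    with assms show ?thesis
      unfolding A_def by blast
  next
    case False
    have CA: "C \<subseteq> A"
      using C by (rule Chains_relation_of)
    have chain: "x \<le> y \<or> y \<le> x" if "x \<in> C" "y \<in> C" for x y
      using C that by (auto simp: Chains_def relation_of_def)
    \<comment> \<open>A nonempty chain is a filter base, so whatever holds eventually in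
      \<open>Inf C\<close> already holds eventually in a member of \<open>C\<close>. As no member is
      \<open>bot\<close>, neither is \<open>Inf C\<close>.\<close>
    have "\<exists>z\<in>C. z \<le> inf x y" if "x \<in> C" "y \<in> C" for x y
      using chain[OF that] that by (metis inf.absorb1 inf.absorb2 order_refl)
    then have "eventually Q (Inf C) \<longleftrightarrow> (\<exists>b\<in>C. eventually Q b)" for Q
      using False by (intro eventually_Inf_base) auto
    then have "Inf C \<noteq> bot"
      using CA by (auto simp: trivial_limit_def A_def)
    moreover have "Inf C \<le> G"
    proof -
      obtain c where "c \<in> C" "c \<le> G"
        using False CA by (auto simp: A_def)
      then show ?thesis
        by (rule Inf_lower2)
    qed
    ultimately show ?thesis
      by (intro bexI[of _ "Inf C"]) (auto simp: A_def Inf_lower)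
  qed
  obtain U where U: "U \<in> A" "\<forall>a\<in>A. U \<ge> a \<longrightarrow> a = U"
    using predicate_Zorn[OF po ub] by blast
  have "U \<le> G"
    using U by (simp add: A_def)
  moreover have "ultrafilter_on I U"
    unfolding ultrafilter_on_def
  proof (intro conjI allI impI)
    show "U \<noteq> bot"
      using U by (simp add: A_def)
    show ev: "\<forall>\<^sub>F i in U. i \<in> I"
      using assms(2) \<open>U \<le> G\<close> by (rule filter_leD[rotated])
    fix S assume "S \<subseteq> I"
    show "(\<forall>\<^sub>F i in U. i \<in> S) \<or> (\<forall>\<^sub>F i in U. i \<in> I - S)"
    proof (cases "inf U (principal S) = bot")
      case True
      then have "\<forall>\<^sub>F i in U. i \<notin> S"
        by (simp add: trivial_limit_def eventually_inf_principal)
      with ev have "\<forall>\<^sub>F i in U. i \<in> I - S"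
        by eventually_elim simp
      then show ?thesis ..
    next
      case False
      then have "inf U (principal S) \<in> A"
        using \<open>U \<le> G\<close> by (auto simp: A_def intro: le_infI1)
      then have "inf U (principal S) = U"
        using U(2) by simp
      then have "U \<le> principal S"
        by (simp add: inf.order_iff)
      then show ?thesis
        by (simp add: le_principal)
    qed
  qed
  ultimately show thesis ..
qed

text \<open>The finite intersection property, relative to \<open>I\<close>. Keeping \<open>I\<close>
  as a separate factor makes the filter concentrated on \<open>I\<close> even when \<open>C\<close>
  is empty, as the construction of an ultrafilter on \<open>I\<close> requires.\<close>

lemma principal_INF_neq_bot:
  assumes "\<And>X. X \<subseteq> C \<Longrightarrow> finite X \<Longrightarrow> I \<inter> \<Inter>X \<noteq> {}"
  shows "inf (principal I) (INF S\<in>C. principal S) \<noteq> bot"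
proof -
  have "(INF S\<in>insert I C. principal S) \<noteq> bot"
  proof (rule INF_filter_not_bot)
    fix X assume X: "X \<subseteq> insert I C" "finite X"
    have "I \<inter> \<Inter>(X - {I}) \<noteq> {}"
      using X by (intro assms) auto
    then have "\<Inter>X \<noteq> {}"
      by blast
    then show "(INF S\<in>X. principal S) \<noteq> bot"
      using X by (simp add: INF_principal_finite principal_eq_bot_iff)
  qed
  then show ?thesis
    by simp
qed

lemma ultrafilter_on_cases:
  assumes "ultrafilter_on I U"
  shows "(\<forall>\<^sub>F i in U. Q i) \<or> (\<forall>\<^sub>F i in U. \<not> Q i)"
proof -
  have "(\<forall>\<^sub>F i in U. i \<in> {i \<in> I. Q i}) \<or> (\<forall>\<^sub>F i in U. i \<in> I - {i \<in> I. Q i})"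
    using assms Collect_restrict[of I Q] unfolding ultrafilter_on_def by blast
  then show ?thesis
  proof
    assume "\<forall>\<^sub>F i in U. i \<in> {i \<in> I. Q i}"
    then have "\<forall>\<^sub>F i in U. Q i"
      by (rule eventually_mono) simp
    then show ?thesis ..
  next
    assume "\<forall>\<^sub>F i in U. i \<in> I - {i \<in> I. Q i}"
    then have "\<forall>\<^sub>F i in U. \<not> Q i"
      by (rule eventually_mono) simp
    then show ?thesis ..
  qed
qed

text \<open>Compactness of \<open>{-c..c}\<close> gives a cluster point of the image filter. An
  ultrafilter decides each neighbourhood of that point and cannot eventually avoid it, so the
  cluster point is a limit.\<close>

lemma ultrafilter_on_bounded_tendsto:
  fixes g :: "'i \<Rightarrow> real"
  assumes U: "ultrafilter_on I U" and g: "\<And>i. i \<in> I \<Longrightarrow> \<bar>g i\<bar> \<le> c"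
  obtains l where "(g \<longlongrightarrow> l) U"
proof -
  have "filtermap g U \<noteq> bot"
    using U by (simp add: ultrafilter_on_def filtermap_bot_iff)
  moreover have "eventually (\<lambda>x. x \<in> {-c..c}) (filtermap g U)"
    unfolding eventually_filtermap
    using U g by (auto simp: ultrafilter_on_def abs_le_iff minus_le_iff elim!: eventually_mono)
  ultimately obtain l where l: "inf (nhds l) (filtermap g U) \<noteq> bot"
    using compact_Icc[of "-c" c] unfolding compact_filter by blast
  have "(g \<longlongrightarrow> l) U"
    unfolding tendsto_def
  proof (intro allI impI)
    fix S assume S: "open S" "l \<in> S"
    have "\<not> (\<forall>\<^sub>F i in U. g i \<notin> S)"
    proof
      assume "\<forall>\<^sub>F i in U. g i \<notin> S"
      then have "eventually (\<lambda>x. x \<notin> S) (filtermap g U)"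
        by (simp add: eventually_filtermap)
      moreover have "eventually (\<lambda>x. x \<in> S) (nhds l)"
        using S by (simp add: eventually_nhds_in_open)
      ultimately have "eventually (\<lambda>_. False) (inf (nhds l) (filtermap g U))"
        unfolding eventually_inf by blast
      with l show False
        by (simp add: trivial_limit_def)
    qed
    then show "\<forall>\<^sub>F i in U. g i \<in> S"
      using ultrafilter_on_cases[OF U] by blast
  qed
  then show thesis ..
qed

section \<open>The type topology\<close>

lemma topspace_type_topology [simp]: "topspace (type_topology L Ps) = L"
  unfolding type_topology_def topology_generated_by_topspace Union_insert by (rule Un_absorb2) auto

lemma continuous_map_type_topology_predicate:
  assumes "Q \<in> Ps"
  shows "continuous_map (type_topology L Ps) euclideanreal Q"
  unfolding continuous_map_def
proof (intro conjI allI impI)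
  fix S :: "real set" assume "openin euclideanreal S"
  then have S: "open S"
    by simp
  show "openin (type_topology L Ps) {x \<in> topspace (type_topology L Ps). Q x \<in> S}"
  proof (subst openin_subopen, clarsimp)
    fix v assume v: "v \<in> L" "Q v \<in> S"
    then obtain e where e: "e > 0" "ball (Q v) e \<subseteq> S"
      using S openE by blast
    show "\<exists>T. openin (type_topology L Ps) T \<and> v \<in> T \<and> T \<subseteq> {x \<in> L. Q x \<in> S}"
    proof (intro exI conjI)
      show "openin (type_topology L Ps) {w \<in> L. type_dist Q v w < e}"
        unfolding type_topology_def
        using assms v e by (intro topology_generated_by_Basis) blast
      show "{w \<in> L. type_dist Q v w < e} \<subseteq> {x \<in> L. Q x \<in> S}"
        using e by (auto simp: type_dist_def subset_iff dist_real_def)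
    qed (use v e in \<open>auto simp: type_dist_def\<close>)
  qed
qed auto

lemma continuous_map_real_uniform_limit:
  fixes \<xi> :: "'a \<Rightarrow> real"
  assumes "\<And>\<epsilon>. \<epsilon> > 0 \<Longrightarrow>
    \<exists>\<eta>. continuous_map X euclideanreal \<eta> \<and> (\<forall>v\<in>topspace X. \<bar>\<eta> v - \<xi> v\<bar> < \<epsilon>)"
  shows "continuous_map X euclideanreal \<xi>"
proof -
  have "\<exists>\<eta>. continuous_map X euclideanreal \<eta> \<and> (\<forall>v\<in>topspace X. \<bar>\<eta> v - \<xi> v\<bar> < 1 / real (Suc n))" for n
    by (intro assms) simp
  then obtain \<eta> where \<eta>: "\<And>n. continuous_map X euclideanreal (\<eta> n)"
    "\<And>n v. v \<in> topspace X \<Longrightarrow> \<bar>\<eta> n v - \<xi> v\<bar> < 1 / real (Suc n)"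
    by metis
  \<comment> \<open>\<open>Met_TC.mtopology\<close> is the euclidean topology, written as a metric
    topology so that the uniform limit theorem for maps into metric spaces applies.\<close>
  have "continuous_map X Met_TC.mtopology \<xi>"
  proof (rule Met_TC.continuous_map_uniform_limit_alt)
    show "\<forall>\<^sub>F n in sequentially. continuous_map X Met_TC.mtopology (\<eta> n)"
      using \<eta>(1) by simp
    fix \<epsilon> :: real assume "\<epsilon> > 0"
    then have "\<forall>\<^sub>F n in sequentially. 1 / real (Suc n) < \<epsilon>"
      using LIMSEQ_inverse_real_of_nat by (simp add: order_tendstoD(2) inverse_eq_divide)
    then show "\<forall>\<^sub>F n in sequentially. \<forall>x\<in>topspace X. dist (\<eta> n x) (\<xi> x) < \<epsilon>"
    proof eventually_elim
      case (elim n)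
      then show ?case
        using \<eta>(2)[of _ n] by (auto simp: dist_real_def intro: less_trans)
    qed
  qed auto
  then show ?thesis
    by simp
qed

text \<open>The connectives produce functions restricted to the space. Each case proves continuity
  of the unrestricted operation and transfers it by agreement on \<open>topspace X\<close>.\<close>

lemma continuous_map_connective_closure:
  assumes "\<eta> \<in> connective_closure (topspace X) A"
    and "\<And>a. a \<in> A \<Longrightarrow> continuous_map X euclideanreal a"
  shows "continuous_map X euclideanreal \<eta>"
  using assms(1)
proof induction
  case (const c)
  show ?case
    by (rule continuous_map_eq[where f = "\<lambda>_. c"]) auto
next
  case (base a)
  then show ?case
    by (rule assms(2))
next
  case (add a b)
  then show ?case
    by - (rule continuous_map_eq[OF continuous_map_add], auto)
next
  case (scale a c)
  then show ?case
    by - (rule continuous_map_eq[OF continuous_map_real_mult_left], auto)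
next
  case (max a b)
  then show ?case
    by - (rule continuous_map_eq[OF continuous_map_real_max], auto)
next
  case (min a b)
  then show ?case
    by - (rule continuous_map_eq[OF continuous_map_real_min], auto)
qed

lemma connective_closure_mono:
  assumes "A \<subseteq> B"
  shows "connective_closure L A \<subseteq> connective_closure L B"
proof
  fix \<eta> assume "\<eta> \<in> connective_closure L A"
  then show "\<eta> \<in> connective_closure L B"
    by induction (use assms in \<open>(blast intro: connective_closure.intros)+\<close>)
qed

section \<open>Lattice approximation on compact spaces\<close>

text \<open>Iterates the binary closure property. Both clauses serve the lattice argument: lying
  below every \<open>g k\<close> transfers upper estimates, and coinciding pointwise with some
  \<open>g k\<close> transfers lower ones.\<close>

lemma ex_finite_min:
  fixes g :: "'b \<Rightarrow> 'a \<Rightarrow> real"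
  assumes "finite K" "K \<noteq> {}" "\<And>k. k \<in> K \<Longrightarrow> g k \<in> G"
    and "\<And>a b. a \<in> G \<Longrightarrow> b \<in> G \<Longrightarrow> (\<lambda>v\<in>S. min (a v) (b v)) \<in> G"
  shows "\<exists>m\<in>G. \<forall>u\<in>S. (\<forall>k\<in>K. m u \<le> g k u) \<and> (\<exists>k\<in>K. m u = g k u)"
  using assms(1-3)
proof (induction rule: finite_ne_induct)
  case (singleton k)
  then show ?case
    by auto
next
  case (insert k K)
  then obtain m where m: "m \<in> G" "\<forall>u\<in>S. (\<forall>k\<in>K. m u \<le> g k u) \<and> (\<exists>k\<in>K. m u = g k u)"
    by auto
  have "(\<lambda>v\<in>S. min (g k v) (m v)) \<in> G"
    using insert.prems m by (intro assms(4)) auto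
  moreover have "\<forall>u\<in>S. (\<forall>j\<in>insert k K. (\<lambda>v\<in>S. min (g k v) (m v)) u \<le> g j u) \<and>
      (\<exists>j\<in>insert k K. (\<lambda>v\<in>S. min (g k v) (m v)) u = g j u)"
    using m(2) by (auto simp: min_def) (meson order_trans linear)+
  ultimately show ?case
    by blast
qed

lemma ex_finite_max:
  fixes g :: "'b \<Rightarrow> 'a \<Rightarrow> real"
  assumes "finite K" "K \<noteq> {}" "\<And>k. k \<in> K \<Longrightarrow> g k \<in> G"
    and "\<And>a b. a \<in> G \<Longrightarrow> b \<in> G \<Longrightarrow> (\<lambda>v\<in>S. max (a v) (b v)) \<in> G"
  shows "\<exists>m\<in>G. \<forall>u\<in>S. (\<forall>k\<in>K. g k u \<le> m u) \<and> (\<exists>k\<in>K. m u = g k u)"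
  using assms(1-3)
proof (induction rule: finite_ne_induct)
  case (singleton k)
  then show ?case
    by auto
next
  case (insert k K)
  then obtain m where m: "m \<in> G" "\<forall>u\<in>S. (\<forall>k\<in>K. g k u \<le> m u) \<and> (\<exists>k\<in>K. m u = g k u)"
    by auto
  have "(\<lambda>v\<in>S. max (g k v) (m v)) \<in> G"
    using insert.prems m by (intro assms(4)) auto
  moreover have "\<forall>u\<in>S. (\<forall>j\<in>insert k K. g j u \<le> (\<lambda>v\<in>S. max (g k v) (m v)) u) \<and>
      (\<exists>j\<in>insert k K. (\<lambda>v\<in>S. max (g k v) (m v)) u = g j u)"
    using m(2) by (auto simp: max_def) (meson order_trans linear)+
  ultimately show ?case
    by blast
qed

lemma compact_space_finite_subcover_points:
  assumes "compact_space X"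
    and "\<And>x. x \<in> topspace X \<Longrightarrow> openin X (W x)" and "\<And>x. x \<in> topspace X \<Longrightarrow> x \<in> W x"
  obtains K where "finite K" "K \<subseteq> topspace X" "topspace X \<subseteq> (\<Union>x\<in>K. W x)"
proof -
  have "compactin X (topspace X)"
    using assms(1) by (simp add: compact_space_def)
  moreover have "\<forall>U\<in>W ` topspace X. openin X U" "topspace X \<subseteq> \<Union>(W ` topspace X)"
    using assms(2,3) by auto
  ultimately obtain \<F> where "finite \<F>" "\<F> \<subseteq> W ` topspace X" "topspace X \<subseteq> \<Union>\<F>"
    unfolding compactin_def by metis
  then show thesis
    using that by (metis finite_subset_image)
qed

text \<open>Fix \<open>v\<close> and choose for each \<open>w\<close> a member of \<open>G\<close>
  close to \<open>\<xi>\<close> at both points. Its upper estimate persists near \<open>w\<close>,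
  so a minimum over a finite subcover is below \<open>\<xi> + \<epsilon>\<close> everywhere and
  still above \<open>\<xi> - \<epsilon>\<close> at \<open>v\<close>. Letting \<open>v\<close> vary,
  a finite maximum of such minima also gains the lower estimate everywhere.\<close>

lemma lattice_approximation:
  fixes \<xi> :: "'a \<Rightarrow> real"
  assumes X: "compact_space X" and ne: "topspace X \<noteq> {}"
    and \<xi>: "continuous_map X euclideanreal \<xi>"
    and cont: "\<And>a. a \<in> G \<Longrightarrow> continuous_map X euclideanreal a"
    and min: "\<And>a b. a \<in> G \<Longrightarrow> b \<in> G \<Longrightarrow> (\<lambda>v\<in>topspace X. min (a v) (b v)) \<in> G"
    and max: "\<And>a b. a \<in> G \<Longrightarrow> b \<in> G \<Longrightarrow> (\<lambda>v\<in>topspace X. max (a v) (b v)) \<in> G"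
    and two_point: "\<And>v w. v \<in> topspace X \<Longrightarrow> w \<in> topspace X \<Longrightarrow>
      \<exists>a\<in>G. \<bar>a v - \<xi> v\<bar> < \<epsilon> \<and> \<bar>a w - \<xi> w\<bar> < \<epsilon>"
  shows "\<exists>a\<in>G. \<forall>v\<in>topspace X. \<bar>a v - \<xi> v\<bar> < \<epsilon>"
proof -
  let ?S = "topspace X"
  have diff: "continuous_map X euclideanreal (\<lambda>u. a u - \<xi> u)" if "a \<in> G" for a
    using that \<xi> cont by (intro continuous_map_diff) auto
  have lt: "openin X {u \<in> ?S. a u - \<xi> u < \<epsilon>}" if "a \<in> G" for a
    using openin_continuous_map_preimage[OF diff[OF that], of "{..<\<epsilon>}"] by simp
  have gt: "openin X {u \<in> ?S. - \<epsilon> < a u - \<xi> u}" if "a \<in> G" for a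
    using openin_continuous_map_preimage[OF diff[OF that], of "{- \<epsilon><..}"] by simp
  have below: "\<exists>m\<in>G. - \<epsilon> < m v - \<xi> v \<and> (\<forall>u\<in>?S. m u - \<xi> u < \<epsilon>)" if v: "v \<in> ?S" for v
  proof -
    obtain g where g: "\<And>w. w \<in> ?S \<Longrightarrow> g w \<in> G \<and> \<bar>g w v - \<xi> v\<bar> < \<epsilon> \<and> \<bar>g w w - \<xi> w\<bar> < \<epsilon>"
      using two_point[OF v] by metis
    have "openin X {u \<in> ?S. g w u - \<xi> u < \<epsilon>}" "w \<in> {u \<in> ?S. g w u - \<xi> u < \<epsilon>}" if "w \<in> ?S" for w
      using g[OF that] lt that by (auto simp: abs_less_iff)
    from compact_space_finite_subcover_points[OF X this]
    obtain K where K: "finite K" "K \<subseteq> ?S" "?S \<subseteq> (\<Union>w\<in>K. {u \<in> ?S. g w u - \<xi> u < \<epsilon>})" .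
    have "K \<noteq> {}"
      using K(3) ne by auto
    have "g k \<in> G" if "k \<in> K" for k
      using K(2) g that by auto
    then have "\<exists>m\<in>G. \<forall>u\<in>?S. (\<forall>k\<in>K. m u \<le> g k u) \<and> (\<exists>k\<in>K. m u = g k u)"
      using K(1) \<open>K \<noteq> {}\<close> min by (intro ex_finite_min)
    then obtain m where m: "m \<in> G" "\<forall>u\<in>?S. (\<forall>k\<in>K. m u \<le> g k u) \<and> (\<exists>k\<in>K. m u = g k u)"
      by blast
    have "- \<epsilon> < m v - \<xi> v"
    proof -
      obtain k where "k \<in> K" "m v = g k v"
        using m(2) v by blast
      moreover have "\<bar>g k v - \<xi> v\<bar> < \<epsilon>"
        using g K(2) \<open>k \<in> K\<close> by blast
      ultimately show ?thesis
        by linarith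
    qed
    moreover have "m u - \<xi> u < \<epsilon>" if u: "u \<in> ?S" for u
    proof -
      obtain k where "k \<in> K" "g k u - \<xi> u < \<epsilon>"
        using K(3) u by blast
      moreover have "m u \<le> g k u"
        using m(2) u \<open>k \<in> K\<close> by blast
      ultimately show ?thesis
        by linarith
    qed
    ultimately show ?thesis
      using m(1) by blast
  qed
  \<comment> \<open>Second use of compactness: \<open>g v\<close> is now the minimum belonging to
    \<open>v\<close>, globally below \<open>\<xi> + \<epsilon>\<close>, and its lower estimate at
    \<open>v\<close> spreads to a neighbourhood of \<open>v\<close>.\<close>
  then obtain g where g: "\<And>v. v \<in> ?S \<Longrightarrow> g v \<in> G \<and> - \<epsilon> < g v v - \<xi> v \<and> (\<forall>u\<in>?S. g v u - \<xi> u < \<epsilon>)"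
    by metis
  have "openin X {u \<in> ?S. - \<epsilon> < g w u - \<xi> u}" "w \<in> {u \<in> ?S. - \<epsilon> < g w u - \<xi> u}" if "w \<in> ?S" for w
    using g[OF that] gt that by auto
  from compact_space_finite_subcover_points[OF X this]
  obtain K where K: "finite K" "K \<subseteq> ?S" "?S \<subseteq> (\<Union>w\<in>K. {u \<in> ?S. - \<epsilon> < g w u - \<xi> u})" .
  have "K \<noteq> {}"
    using K(3) ne by auto
  have "g k \<in> G" if "k \<in> K" for k
    using K(2) g that by auto
  then have "\<exists>m\<in>G. \<forall>u\<in>?S. (\<forall>k\<in>K. g k u \<le> m u) \<and> (\<exists>k\<in>K. m u = g k u)"
    using K(1) \<open>K \<noteq> {}\<close> max by (intro ex_finite_max)
  then obtain m where m: "m \<in> G" "\<forall>u\<in>?S. (\<forall>k\<in>K. g k u \<le> m u) \<and> (\<exists>k\<in>K. m u = g k u)"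
    by blast
  \<comment> \<open>The upper estimate comes from the index \<open>j\<close> at which the maximum is
    attained, the lower one from an index \<open>k\<close> whose neighbourhood contains
    \<open>u\<close>.\<close>
  have "\<bar>m u - \<xi> u\<bar> < \<epsilon>" if u: "u \<in> ?S" for u
  proof -
    obtain j where "j \<in> K" "m u = g j u"
      using m(2) u by blast
    moreover have "g j u - \<xi> u < \<epsilon>"
      using g K(2) \<open>j \<in> K\<close> u by blast
    moreover obtain k where "k \<in> K" "- \<epsilon> < g k u - \<xi> u"
      using K(3) u by blast
    moreover have "g k u \<le> m u"
      using m(2) u \<open>k \<in> K\<close> by blast
    ultimately show ?thesis
      by linarith
  qed
  with m(1) show ?thesis
    by blast
qed

section \<open>Function types\<close>

context complete_bounded_css
begin

abbreviation "X \<equiv> type_topology L Ps"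

section \<open>Continuity of atomic predicates and compactness of the state space\<close>

lemma continuous_map_comp_predicate:
  assumes "Q \<in> Ps" "g \<in> F"
  shows "continuous_map X euclideanreal (\<lambda>v. Q (g v))"
  using continuous_map_compose[OF continuous[OF assms(2)] continuous_map_type_topology_predicate[OF assms(1)]]
  by (simp add: o_def)

lemma continuous_map_restrict_comp_predicate:
  assumes "Q \<in> Ps" "g \<in> F"
  shows "continuous_map X euclideanreal (\<lambda>v\<in>L. Q (g v))"
  using continuous_map_comp_predicate[OF assms] by (rule continuous_map_eq) auto

text \<open>Each predicate is bounded and hence converges along the family, so the image filter is
  Cauchy for every pseudometric and completeness applies. The limit need not be unique, since
  predicates may fail to separate states.\<close>

lemma ultrafilter_on_limitin:
  assumes V: "ultrafilter_on J V" and v: "v ` J \<subseteq> L"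
  obtains l where "l \<in> L" and "limitin X v l V"
proof -
  have ev: "\<forall>\<^sub>F j in V. v j \<in> L"
    using V v by (auto simp: ultrafilter_on_def elim!: eventually_mono)
  have "type_cauchy_filter Ps (filtermap v V)"
    unfolding type_cauchy_filter_def
  proof (intro ballI allI impI)
    fix Q and e :: real assume Q: "Q \<in> Ps" and "e > 0"
    obtain l where "((\<lambda>j. Q (v j)) \<longlongrightarrow> l) V"
      using ultrafilter_on_bounded_tendsto[OF V, of "\<lambda>j. Q (v j)" "r Q"] bounded[OF Q] v by blast
    then have l: "\<forall>\<^sub>F x in filtermap v V. \<bar>Q x - l\<bar> < e / 2"
      unfolding eventually_filtermap using \<open>e > 0\<close> half_gt_zero tendstoD[of "\<lambda>j. Q (v j)" l V "e / 2"]
      by (simp add: dist_real_def)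
    show "\<forall>\<^sub>F (v, w) in filtermap v V \<times>\<^sub>F filtermap v V. type_dist Q v w < e"
      using eventually_prodI[OF l l]
    proof (rule eventually_mono, safe)
      fix v w assume "\<bar>Q (fst (v, w)) - l\<bar> < e / 2" "\<bar>Q (snd (v, w)) - l\<bar> < e / 2"
      then show "type_dist Q v w < e"
        unfolding type_dist_def fst_conv snd_conv by linarith
    qed
  qed
  moreover have "filtermap v V \<noteq> bot" "\<forall>\<^sub>F x in filtermap v V. x \<in> L"
    using V ev by (auto simp: ultrafilter_on_def filtermap_bot_iff eventually_filtermap)
  ultimately obtain l where "l \<in> L" "limitin X (\<lambda>x. x) l (filtermap v V)"
    using complete unfolding type_complete_def by blast
  then show thesis
    using that by (simp add: limitin_def eventually_filtermap)
qed

text \<open>If a cover had no finite subcover, the complements of its members would have the finite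
  intersection property in \<open>L\<close>. An ultrafilter containing them all converges to some
  \<open>l\<close>, yet must eventually lie in a member of the cover around
  \<open>l\<close>.\<close>

lemma compact_space_type_topology: "compact_space X"
proof (rule ccontr)
  assume "\<not> compact_space X"
  then have "\<exists>\<U>. (\<forall>U\<in>\<U>. openin X U) \<and> L \<subseteq> \<Union>\<U> \<and> \<not> (\<exists>\<F>. finite \<F> \<and> \<F> \<subseteq> \<U> \<and> L \<subseteq> \<Union>\<F>)"
    unfolding compact_space_def compactin_def topspace_type_topology by blast
  then obtain \<U> where \<U>: "\<And>U. U \<in> \<U> \<Longrightarrow> openin X U" "L \<subseteq> \<Union>\<U>"
    and nofin: "\<And>\<F>. finite \<F> \<Longrightarrow> \<F> \<subseteq> \<U> \<Longrightarrow> \<not> L \<subseteq> \<Union>\<F>"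
    by metis
  \<comment> \<open>\<open>uminus\<close> forms complements in the whole type; the factor
    \<open>principal L\<close> brings the filter back to \<open>L\<close>.\<close>
  let ?G = "inf (principal L) (INF S\<in>uminus ` \<U>. principal S)"
  have "?G \<noteq> bot"
  proof (rule principal_INF_neq_bot)
    fix Y assume "Y \<subseteq> uminus ` \<U>" "finite Y"
    then obtain \<F> where \<F>: "finite \<F>" "\<F> \<subseteq> \<U>" "Y = uminus ` \<F>"
      by (meson finite_subset_image)
    with nofin have "\<not> L \<subseteq> \<Union>\<F>"
      by blast
    with \<F>(3) show "L \<inter> \<Inter>Y \<noteq> {}"
      by auto
  qed
  moreover have "\<forall>\<^sub>F v in ?G. v \<in> L"
    by (rule filter_leD[OF inf_le1]) (simp add: eventually_principal)
  ultimately obtain V where V: "V \<le> ?G" "ultrafilter_on L V"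
    by (rule ex_ultrafilter_le)
  obtain l where l: "l \<in> L" "limitin X (\<lambda>v. v) l V"
    using ultrafilter_on_limitin[OF V(2), of "\<lambda>v. v"] by auto
  obtain U where U: "U \<in> \<U>" "l \<in> U"
    using l(1) \<U>(2) by blast
  then have "\<forall>\<^sub>F v in V. v \<in> U"
    using l(2) \<U>(1) by (simp add: limitin_def)
  moreover have "V \<le> principal (- U)"
    using V(1) U(1) by (meson INF_lower image_eqI inf.boundedE order_trans)
  then have "\<forall>\<^sub>F v in V. v \<in> - U"
    by (simp add: le_principal)
  ultimately have "\<forall>\<^sub>F v in V. False"
    by eventually_elim simp
  with V(2) show False
    by (simp add: ultrafilter_on_def trivial_limit_def)
qed

section \<open>Function types as pointwise limits along transformations\<close>

lemma function_types_finite_approx: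
  assumes P: "P \<in> Ps" and \<ff>: "\<ff> \<in> function_types L F r P"
    and K: "finite K" "K \<subseteq> L" and "e > 0"
  shows "\<exists>f\<in>F. \<forall>v\<in>K. \<bar>P (f v) - \<ff> v\<bar> < e"
proof -
  let ?T = "\<lambda>_. top_of_set {- r P..r P}"
  \<comment> \<open>\<open>Pi\<^sub>E L W\<close> is a basic product neighbourhood of
    \<open>\<ff>\<close> restricting only the coordinates in \<open>K\<close>. Elsewhere, also
    outside \<open>L\<close>, \<open>W v\<close> is the full factor, so only finitely many
    coordinates are restricted.\<close>
  define W where "W v = (if v \<in> K then {- r P..r P} \<inter> ball (\<ff> v) e else {- r P..r P})" for v
  have top: "\<ff> \<in> L \<rightarrow>\<^sub>E {- r P..r P}"
    using \<ff> closure_of_subset_topspace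
    unfolding function_types_def by fastforce
  have "openin (?T v) (W v)" for v
    unfolding W_def by auto
  moreover have "finite {v. W v \<noteq> topspace (?T v)}"
    using K(1) by (rule finite_subset[rotated]) (auto simp: W_def)
  ultimately have "openin (product_topology ?T L) (Pi\<^sub>E L W)"
    by (rule product_topology_basis)
  moreover have "\<ff> \<in> Pi\<^sub>E L W"
    using top \<open>e > 0\<close> by (auto simp: PiE_iff W_def)
  ultimately obtain y where "y \<in> {\<lambda>v\<in>L. P (f v) | f. f \<in> F}" "y \<in> Pi\<^sub>E L W"
    using \<ff> unfolding function_types_def in_closure_of by blast
  then obtain f where f: "f \<in> F" "(\<lambda>v\<in>L. P (f v)) \<in> Pi\<^sub>E L W"
    by blast
  have "\<bar>P (f v) - \<ff> v\<bar> < e" if "v \<in> K" for v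
  proof -
    have "(\<lambda>v\<in>L. P (f v)) v \<in> W v"
      using f(2) K(2) that by (meson PiE_mem subsetD)
    then show ?thesis
      using that K(2) by (auto simp: W_def dist_real_def abs_minus_commute)
  qed
  with f(1) show ?thesis
    by blast
qed

text \<open>Approximation at finitely many points says that the sets \<open>N (v, e)\<close> have
  the finite intersection property in \<open>F\<close>. An ultrafilter containing them presents
  \<open>\<ff>\<close> as an ultralimit of the family indexed by \<open>F\<close> itself.\<close>

lemma function_types_ultrafilter:
  assumes P: "P \<in> Ps" and \<ff>: "\<ff> \<in> function_types L F r P"
  obtains U where "ultrafilter_on F U" and "\<And>v. v \<in> L \<Longrightarrow> ((\<lambda>f. P (f v)) \<longlongrightarrow> \<ff> v) U"
proof -
  define N where "N = (\<lambda>(v, e). {f. \<bar>P (f v) - \<ff> v\<bar> < e})"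
  let ?I = "L \<times> {0<..}"
  let ?G = "inf (principal F) (INF S\<in>N ` ?I. principal S)"
  have "?G \<noteq> bot"
  proof (rule principal_INF_neq_bot)
    fix Y assume "Y \<subseteq> N ` ?I" "finite Y"
    then obtain Z where Z: "finite Z" "Z \<subseteq> ?I" "Y = N ` Z"
      by (meson finite_subset_image)
    \<comment> \<open>Inserting \<open>1\<close> keeps the set nonempty, so that \<open>Min\<close>
      is meaningful and positive even when \<open>Z\<close> is empty.\<close>
    define e where "e = Min (insert 1 (snd ` Z))"
    have "e > 0"
      using Z by (auto simp: e_def)
    moreover have "finite (fst ` Z)" "fst ` Z \<subseteq> L"
      using Z by auto
    ultimately obtain f where f: "f \<in> F" "\<forall>v\<in>fst ` Z. \<bar>P (f v) - \<ff> v\<bar> < e"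
      using function_types_finite_approx[OF P \<ff>] by metis
    have "f \<in> N z" if "z \<in> Z" for z
    proof -
      have "e \<le> snd z"
        unfolding e_def using Z(1) that by (intro Min_le) auto
      moreover have "\<bar>P (f (fst z)) - \<ff> (fst z)\<bar> < e"
        using f(2) that by blast
      ultimately show ?thesis
        by (simp add: N_def case_prod_beta)
    qed
    with f(1) Z(3) show "F \<inter> \<Inter>Y \<noteq> {}"
      by auto
  qed
  moreover have "\<forall>\<^sub>F f in ?G. f \<in> F"
    by (rule filter_leD[OF inf_le1]) (simp add: eventually_principal)
  ultimately obtain U where U: "U \<le> ?G" "ultrafilter_on F U"
    by (rule ex_ultrafilter_le)
  have "((\<lambda>f. P (f v)) \<longlongrightarrow> \<ff> v) U" if v: "v \<in> L" for v
    unfolding tendsto_iff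
  proof (intro allI impI)
    fix e :: real assume "e > 0"
    then have "U \<le> principal (N (v, e))"
      using U(1) v by (intro order_trans[OF U(1)] le_infI2 INF_lower) auto
    then show "\<forall>\<^sub>F f in U. dist (P (f v)) (\<ff> v) < e"
      by (simp add: le_principal N_def dist_real_def)
  qed
  with U(2) show thesis
    by (rule that)
qed

section \<open>Definability, continuity and uniform approximation\<close>

lemma definable_imp_continuous:
  assumes "definable_predicate L F Ps \<xi>"
  shows "continuous_map X euclideanreal \<xi>"
proof (rule continuous_map_real_uniform_limit)
  fix \<epsilon> :: real assume "\<epsilon> > 0"
  then obtain \<eta> where \<eta>: "\<eta> \<in> explicit_predicates L F Ps" "\<forall>v\<in>L. \<bar>\<eta> v - \<xi> v\<bar> < \<epsilon>"
    using assms unfolding definable_predicate_def by blast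
  have "continuous_map X euclideanreal \<eta>"
    using \<eta>(1) continuous_map_restrict_comp_predicate
    by (intro continuous_map_connective_closure[of \<eta> X "atomic_predicates L F Ps"])
      (auto simp: explicit_predicates_def atomic_predicates_def)
  with \<eta>(2) show "\<exists>\<eta>. continuous_map X euclideanreal \<eta> \<and> (\<forall>v\<in>topspace X. \<bar>\<eta> v - \<xi> v\<bar> < \<epsilon>)"
    by auto
qed

lemma continuous_imp_uniform_approx:
  assumes P: "P \<in> Ps" and \<ff>: "\<ff> \<in> function_types L F r P"
    and cont: "continuous_map X euclideanreal \<ff>" and "\<epsilon> > 0"
  shows "\<exists>H \<eta>. finite H \<and> H \<subseteq> F \<and> \<eta> \<in> connective_closure L {\<lambda>v\<in>L. P (h v) | h. h \<in> H} \<and>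
    (\<forall>v\<in>L. \<bar>\<eta> v - \<ff> v\<bar> < \<epsilon>)"
\<comment> \<open>Lattice approximation takes minima and maxima over nonempty finite subcovers, so
  the empty space is treated apart.\<close>
proof (cases "L = {}")
  case True
  then show ?thesis
    by (intro exI[of _ "{}"] exI[of _ "\<lambda>v\<in>L. 0"]) (simp add: connective_closure.const del: restrict_apply)
next
  case False
  define A where "A H = {\<lambda>v\<in>L. P (h v) | h. h \<in> H}" for H
  \<comment> \<open>Each member of \<open>G\<close> involves only finitely many transformations.
    \<open>G\<close> is still a lattice, because two members built from \<open>H\<close> and
    \<open>H'\<close> are both built from \<open>H \<union> H'\<close>.\<close>
  define G where "G = (\<Union>H\<in>{H. finite H \<and> H \<subseteq> F}. connective_closure L (A H))"
  have joint: "\<exists>H. finite H \<and> H \<subseteq> F \<and> a \<in> connective_closure L (A H) \<and> b \<in> connective_closure L (A H)"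
    if ab: "a \<in> G" "b \<in> G" for a b
  proof -
    obtain H H' where H: "finite H" "H \<subseteq> F" "a \<in> connective_closure L (A H)"
      "finite H'" "H' \<subseteq> F" "b \<in> connective_closure L (A H')"
      using ab unfolding G_def by blast
    moreover have "A H \<subseteq> A (H \<union> H')" "A H' \<subseteq> A (H \<union> H')"
      by (auto simp: A_def)
    ultimately show ?thesis
      using connective_closure_mono[of "A H" "A (H \<union> H')" L] connective_closure_mono[of "A H'" "A (H \<union> H')" L]
      by (intro exI[of _ "H \<union> H'"]) auto
  qed
  have "\<exists>a\<in>G. \<forall>v\<in>topspace X. \<bar>a v - \<ff> v\<bar> < \<epsilon>"
  proof (rule lattice_approximation)
    show "continuous_map X euclideanreal a" if a: "a \<in> G" for a
    proof -
      obtain H where "H \<subseteq> F" "a \<in> connective_closure L (A H)"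
        using a unfolding G_def by blast
      then show ?thesis
        using continuous_map_restrict_comp_predicate[OF P]
        by (intro continuous_map_connective_closure[of a X "A H"]) (auto simp: A_def)
    qed
    show "(\<lambda>v\<in>topspace X. min (a v) (b v)) \<in> G" if "a \<in> G" "b \<in> G" for a b
      using joint[OF that] unfolding G_def topspace_type_topology by (blast intro: connective_closure.min)
    show "(\<lambda>v\<in>topspace X. max (a v) (b v)) \<in> G" if "a \<in> G" "b \<in> G" for a b
      using joint[OF that] unfolding G_def topspace_type_topology by (blast intro: connective_closure.max)
    fix v w assume vw: "v \<in> topspace X" "w \<in> topspace X"
    then obtain f where f: "f \<in> F" "\<forall>u\<in>{v, w}. \<bar>P (f u) - \<ff> u\<bar> < \<epsilon>"
      using function_types_finite_approx[OF P \<ff>, of "{v, w}" \<epsilon>] \<open>\<epsilon> > 0\<close> by auto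
    have "(\<lambda>u\<in>L. P (f u)) \<in> connective_closure L (A {f})"
      by (rule connective_closure.base) (auto simp: A_def)
    then have "(\<lambda>u\<in>L. P (f u)) \<in> G"
      unfolding G_def using f(1) by (intro UN_I[of "{f}"]) auto
    with f(2) vw show "\<exists>a\<in>G. \<bar>a v - \<ff> v\<bar> < \<epsilon> \<and> \<bar>a w - \<ff> w\<bar> < \<epsilon>"
      by (intro bexI[of _ "\<lambda>u\<in>L. P (f u)"]) auto
  qed (use False cont compact_space_type_topology in auto)
  then show ?thesis
    unfolding G_def A_def by auto
qed

lemma uniform_approx_imp_definable:
  assumes P: "P \<in> Ps"
    and approx: "\<And>\<epsilon>. \<epsilon> > 0 \<Longrightarrow> \<exists>H \<eta>. H \<subseteq> F \<and> \<eta> \<in> connective_closure L {\<lambda>v\<in>L. P (h v) | h. h \<in> H} \<and>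
      (\<forall>v\<in>L. \<bar>\<eta> v - \<xi> v\<bar> < \<epsilon>)"
  shows "definable_predicate L F Ps \<xi>"
  unfolding definable_predicate_def
proof (intro allI impI)
  fix \<epsilon> :: real assume "\<epsilon> > 0"
  then obtain H \<eta> where H: "H \<subseteq> F" "\<eta> \<in> connective_closure L {\<lambda>v\<in>L. P (h v) | h. h \<in> H}"
    "\<forall>v\<in>L. \<bar>\<eta> v - \<xi> v\<bar> < \<epsilon>"
    using approx by blast
  have "{\<lambda>v\<in>L. P (h v) | h. h \<in> H} \<subseteq> atomic_predicates L F Ps"
    using H(1) P unfolding atomic_predicates_def by blast
  with H show "\<exists>\<eta>\<in>explicit_predicates L F Ps. \<forall>v\<in>L. \<bar>\<eta> v - \<xi> v\<bar> < \<epsilon>"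
    using connective_closure_mono unfolding explicit_predicates_def by blast
qed

section \<open>Continuity and exchange of iterated ultralimits\<close>

lemma continuous_imp_iterated_limits_commute:
  assumes P: "P \<in> Ps" and cont: "continuous_map X euclideanreal \<ff>"
  shows "iterated_limits_commute L F P \<ff> I J"
  unfolding iterated_limits_commute_def
proof (intro allI impI, elim conjE)
  fix f U v V
  assume f: "f ` I \<subseteq> F" and U: "ultrafilter_on I U"
    and lim: "\<forall>v\<in>L. ((\<lambda>i. P (f i v)) \<longlongrightarrow> \<ff> v) U"
    and v: "v ` J \<subseteq> L" and V: "ultrafilter_on J V"
  have nb: "U \<noteq> bot" "V \<noteq> bot" and evI: "\<forall>\<^sub>F i in U. i \<in> I" and evJ: "\<forall>\<^sub>F j in V. j \<in> J"
    using U V by (auto simp: ultrafilter_on_def)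
  \<comment> \<open>Both iterated limits equal \<open>\<ff> l\<close> for a limit \<open>l\<close>
    of the family \<open>v\<close>: in one order by continuity of each \<open>P (f i _)\<close>
    followed by the limit along \<open>U\<close>, in the other by continuity of \<open>\<ff>\<close>
    itself.\<close>
  obtain l where l: "l \<in> L" "limitin X v l V"
    using ultrafilter_on_limitin[OF V v] .
  have along: "((\<lambda>j. g (v j)) \<longlongrightarrow> g l) V" if "continuous_map X euclideanreal g" for g
    using continuous_map_limit[OF that l(2)] by (simp add: o_def)
  have "\<forall>\<^sub>F i in U. P (f i l) = Lim V (\<lambda>j. P (f i (v j)))"
    using evI
  proof eventually_elim
    case (elim i)
    then have "f i \<in> F"
      using f by blast
    from tendsto_Lim[OF nb(2) along[OF continuous_map_comp_predicate[OF P this]]] show ?case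
      by simp
  qed
  then have "((\<lambda>i. Lim V (\<lambda>j. P (f i (v j)))) \<longlongrightarrow> \<ff> l) U"
    using lim l(1) by (auto intro: Lim_transform_eventually)
  moreover have "\<forall>\<^sub>F j in V. \<ff> (v j) = Lim U (\<lambda>i. P (f i (v j)))"
    using evJ
  proof eventually_elim
    case (elim j)
    then have "((\<lambda>i. P (f i (v j))) \<longlongrightarrow> \<ff> (v j)) U"
      using lim v by blast
    from tendsto_Lim[OF nb(1) this] show ?case
      by simp
  qed
  then have "((\<lambda>j. Lim U (\<lambda>i. P (f i (v j)))) \<longlongrightarrow> \<ff> l) V"
    using along[OF cont] by (auto intro: Lim_transform_eventually)
  ultimately show "Lim U (\<lambda>i. Lim V (\<lambda>j. P (f i (v j)))) = Lim V (\<lambda>j. Lim U (\<lambda>i. P (f i (v j))))"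
    using nb by (simp add: tendsto_Lim)
qed

text \<open>
  At a point \<open>v\<close> of discontinuity, an ultrafilter on \<open>L\<close> that converges to \<open>v\<close> but stays in a set
  on which \<open>\<ff>\<close> differs from \<open>\<ff> v\<close> by at least \<open>e\<close> separates the two iterated limits.
\<close>

lemma iterated_limits_commute_imp_continuous:
  assumes P: "P \<in> Ps" and \<ff>: "\<ff> \<in> function_types L F r P"
    and comm: "iterated_limits_commute L F P \<ff> F L"
  shows "continuous_map X euclideanreal \<ff>"
proof (rule ccontr)
  assume "\<not> continuous_map X euclideanreal \<ff>"
  then obtain v e where v: "v \<in> L" and "e > 0"
    and bad: "\<And>S. openin X S \<Longrightarrow> v \<in> S \<Longrightarrow> \<exists>w\<in>S. e \<le> \<bar>\<ff> w - \<ff> v\<bar>"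
  proof -
    have "\<not> continuous_map X Met_TC.mtopology \<ff>"
      using \<open>\<not> continuous_map X euclideanreal \<ff>\<close> by simp
    then show thesis
      using that unfolding Met_TC.continuous_map_to_metric
      by (auto simp: dist_real_def not_less abs_minus_commute)
  qed
  define B where "B = {w \<in> L. e \<le> \<bar>\<ff> w - \<ff> v\<bar>}"
  let ?N = "{S. openin X S \<and> v \<in> S}"
  let ?G = "inf (principal B) (INF S\<in>?N. principal S)"
  have "?G \<noteq> bot"
  proof (rule principal_INF_neq_bot)
    fix Y assume Y: "Y \<subseteq> ?N" "finite Y"
    \<comment> \<open>For empty \<open>Y\<close> the intersection is the whole type; intersecting
      with \<open>L\<close> makes it open in that case too.\<close>
    have "openin X (L \<inter> \<Inter>Y)"
      using Y openin_topspace[of X] by (intro openin_Int_Inter) auto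
    moreover have "v \<in> L \<inter> \<Inter>Y"
      using Y v by auto
    ultimately show "B \<inter> \<Inter>Y \<noteq> {}"
      using bad unfolding B_def by blast
  qed
  moreover have evB: "\<forall>\<^sub>F w in ?G. w \<in> B"
    by (rule filter_leD[OF inf_le1]) (simp add: eventually_principal)
  then have "\<forall>\<^sub>F w in ?G. w \<in> L"
    by (rule eventually_mono) (simp add: B_def)
  ultimately obtain V where V: "V \<le> ?G" "ultrafilter_on L V"
    by (rule ex_ultrafilter_le)
  then have nbV: "V \<noteq> bot" and evL: "\<forall>\<^sub>F w in V. w \<in> L"
    by (auto simp: ultrafilter_on_def)
  have limV: "limitin X (\<lambda>w. w) v V"
    unfolding limitin_def
  proof (intro conjI allI impI)
    fix S assume "openin X S \<and> v \<in> S"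
    then have "V \<le> principal S"
      using V(1) by (intro order_trans[OF V(1)] le_infI2 INF_lower) auto
    then show "\<forall>\<^sub>F w in V. w \<in> S"
      by (simp add: le_principal)
  qed (use v in simp)
  obtain U where U: "ultrafilter_on F U" "\<And>v. v \<in> L \<Longrightarrow> ((\<lambda>f. P (f v)) \<longlongrightarrow> \<ff> v) U"
    using function_types_ultrafilter[OF P \<ff>] by blast
  then have nbU: "U \<noteq> bot" and evF: "\<forall>\<^sub>F f in U. f \<in> F"
    by (auto simp: ultrafilter_on_def)
  have "\<forall>\<^sub>F f in U. P (f v) = Lim V (\<lambda>w. P (f w))"
    using evF
  proof eventually_elim
    case (elim f)
    have "((\<lambda>w. P (f w)) \<longlongrightarrow> P (f v)) V"
      using continuous_map_limit[OF continuous_map_comp_predicate[OF P elim] limV] by (simp add: o_def)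
    from tendsto_Lim[OF nbV this] show ?case
      by simp
  qed
  then have "((\<lambda>f. Lim V (\<lambda>w. P (f w))) \<longlongrightarrow> \<ff> v) U"
    using U(2)[OF v] by (rule Lim_transform_eventually[rotated])
  then have "\<ff> v = Lim U (\<lambda>f. Lim V (\<lambda>w. P (f w)))"
    using nbU by (simp add: tendsto_Lim)
  \<comment> \<open>The exchange hypothesis is applied to the identity families on \<open>F\<close>
    and \<open>L\<close>.\<close>
  also have "\<dots> = Lim V (\<lambda>w. Lim U (\<lambda>f. P (f w)))"
    using comm[unfolded iterated_limits_commute_def, rule_format, of "\<lambda>f. f" U "\<lambda>w. w" V] U V(2)
    by simp
  finally have eq: "Lim V (\<lambda>w. Lim U (\<lambda>f. P (f w))) = \<ff> v"
    by simp
  have \<ff>_eq: "\<forall>\<^sub>F w in V. \<ff> w = Lim U (\<lambda>f. P (f w))"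
    using evL by eventually_elim (metis U(2) nbU tendsto_Lim)
  \<comment> \<open>An equation between \<open>Lim\<close> values does not by itself assert
    convergence. Boundedness of \<open>\<ff>\<close> supplies a genuine limit \<open>l\<close> along
    \<open>V\<close>, which the equation then identifies with \<open>\<ff> v\<close>.\<close>
  have "\<ff> \<in> L \<rightarrow>\<^sub>E {- r P..r P}"
    using \<ff> closure_of_subset_topspace unfolding function_types_def by fastforce
  then have "\<bar>\<ff> w\<bar> \<le> r P" if "w \<in> L" for w
    using that by (force simp: PiE_iff abs_le_iff)
  then obtain l where l: "(\<ff> \<longlongrightarrow> l) V"
    using ultrafilter_on_bounded_tendsto[OF V(2), of \<ff>] by blast
  then have "((\<lambda>w. Lim U (\<lambda>f. P (f w))) \<longlongrightarrow> l) V"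
    using \<ff>_eq by (rule Lim_transform_eventually)
  with eq have "l = \<ff> v"
    using nbV by (simp add: tendsto_Lim)
  with l \<open>e > 0\<close> have "\<forall>\<^sub>F w in V. \<bar>\<ff> w - \<ff> v\<bar> < e"
    by (auto simp: tendsto_iff dist_real_def)
  moreover have "\<forall>\<^sub>F w in V. w \<in> B"
    using V(1) evB by (rule filter_leD)
  ultimately have "\<forall>\<^sub>F w in V. False"
    by eventually_elim (simp add: B_def)
  with nbV show False
    by (simp add: trivial_limit_def)
qed

end

theorem theorem3p4:
  fixes L :: "'a set"
    and F :: "('a \<Rightarrow> 'a) set"
    and Ps :: "('a \<Rightarrow> real) set"
    and r :: "('a \<Rightarrow> real) \<Rightarrow> real"
    and P \<ff> :: "'a \<Rightarrow> real"
  assumes "complete_bounded_css L F Ps r"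
    and "P \<in> Ps"
    and "\<ff> \<in> function_types L F r P"
  shows
    "(definable_predicate L F Ps \<ff> \<longleftrightarrow>
        continuous_map (type_topology L Ps) euclideanreal \<ff>) \<and>
     (continuous_map (type_topology L Ps) euclideanreal \<ff> \<longleftrightarrow>
        iterated_limits_commute_canonical L F P \<ff>) \<and>
     (continuous_map (type_topology L Ps) euclideanreal \<ff> \<longrightarrow>
        (\<forall>(I :: 'i set) (J :: 'j set). iterated_limits_commute L F P \<ff> I J)) \<and>
     (continuous_map (type_topology L Ps) euclideanreal \<ff> \<longleftrightarrow>
        (\<forall>\<epsilon>>0. \<exists>H \<eta>. finite H \<and> H \<subseteq> F \<and>
           \<eta> \<in> connective_closure L {\<lambda>v\<in>L. P (h v) | h. h \<in> H} \<and>
           (SUP v\<in>L. ereal \<bar>\<eta> v - \<ff> v\<bar>) < ereal \<epsilon>))"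
    (is "(?def \<longleftrightarrow> ?cont) \<and> (?cont \<longleftrightarrow> ?comm) \<and> (?cont \<longrightarrow> ?comm') \<and> (?cont \<longleftrightarrow> ?approx)")
proof -
  interpret complete_bounded_css L F Ps r
    by fact
  have def_cont: ?cont if ?def
    using that by (rule definable_imp_continuous)
  have comm: ?comm' if ?cont
    using continuous_imp_iterated_limits_commute[OF assms(2) that] by blast
  have comm_canonical: ?comm if ?cont
    using continuous_imp_iterated_limits_commute[OF assms(2) that]
    unfolding iterated_limits_commute_canonical_def by blast
  have comm_cont: ?cont if ?comm
    using iterated_limits_commute_imp_continuous[OF assms(2,3)] that
    unfolding iterated_limits_commute_canonical_def by blast
  have cont_approx: ?approx if cont: ?cont
  proof (intro allI impI)
    fix \<epsilon> :: real assume "\<epsilon> > 0"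
    then obtain H \<eta> where H: "finite H" "H \<subseteq> F"
      "\<eta> \<in> connective_closure L {\<lambda>v\<in>L. P (h v) | h. h \<in> H}" "\<forall>v\<in>L. \<bar>\<eta> v - \<ff> v\<bar> < \<epsilon> / 2"
      using continuous_imp_uniform_approx[OF assms(2,3) cont, of "\<epsilon> / 2"] by auto
    \<comment> \<open>Strict pointwise bounds give only a weak bound on the supremum, hence the
      choice of \<open>\<epsilon> / 2\<close>. In \<open>ereal\<close> an empty supremum is minus
      infinity, so empty \<open>L\<close> is covered.\<close>
    have "(SUP v\<in>L. ereal \<bar>\<eta> v - \<ff> v\<bar>) \<le> ereal (\<epsilon> / 2)"
      using H(4) by (intro SUP_least) (simp add: less_imp_le)
    also have "\<dots> < ereal \<epsilon>"
      using \<open>\<epsilon> > 0\<close> by simp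
    finally show "\<exists>H \<eta>. finite H \<and> H \<subseteq> F \<and>
       \<eta> \<in> connective_closure L {\<lambda>v\<in>L. P (h v) | h. h \<in> H} \<and>
       (SUP v\<in>L. ereal \<bar>\<eta> v - \<ff> v\<bar>) < ereal \<epsilon>"
      using H by blast
  qed
  have approx_def: ?def if ?approx
  proof (rule uniform_approx_imp_definable[OF assms(2)])
    fix \<epsilon> :: real assume "\<epsilon> > 0"
    then obtain H \<eta> where H: "H \<subseteq> F" "\<eta> \<in> connective_closure L {\<lambda>v\<in>L. P (h v) | h. h \<in> H}"
      "(SUP v\<in>L. ereal \<bar>\<eta> v - \<ff> v\<bar>) < ereal \<epsilon>"
      using \<open>?approx\<close> by blast
    have "\<bar>\<eta> v - \<ff> v\<bar> < \<epsilon>" if "v \<in> L" for v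
    proof -
      have "ereal \<bar>\<eta> v - \<ff> v\<bar> < ereal \<epsilon>"
        using SUP_upper[OF that] H(3) by (rule le_less_trans)
      then show ?thesis
        by simp
    qed
    with H show "\<exists>H \<eta>. H \<subseteq> F \<and> \<eta> \<in> connective_closure L {\<lambda>v\<in>L. P (h v) | h. h \<in> H} \<and>
        (\<forall>v\<in>L. \<bar>\<eta> v - \<ff> v\<bar> < \<epsilon>)"
      by blast
  qed
  \<comment> \<open>Definability, continuity and approximation form a cycle of implications;
    exchange of limits is tied to continuity in both directions.\<close>
  show ?thesis
    using def_cont comm comm_canonical comm_cont cont_approx approx_def by blast
qed

end
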